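(* Let $(M,\langle\,,\rangle)$ be a Riemannian manifold. If a proper torse-forming vector field $\mathcal{V}$ on $M$ is of constant length, then $\mathcal{V}$ is parallel (in the sense of collinear) to its generative $\mathcal{W}$. In particular, every unit torse-forming vector field (that is, every torse-forming vector field $\mathcal{V}$ with $|\mathcal{V}|=1$) is an anti-torqued vector field.
   Context: Let $(M,\langle\,,\rangle)$ be a Riemannian manifold with Levi-Civita connection $\nabla^0$, and let $\mathfrak{X}(M)$ denote the smooth vector fields on $M$. A nowhere zero smooth vector field $\mathcal{V}$ on $M$ is called torse-forming if there are a smooth function $f$ and a $1$-form $\omega$ on $M$ with $$\nabla^0_X\mathcal{V}=fX+\omega(X)\mathcal{V}\quad\text{for all }X\in\mathfrak{X}(M).$$ Here $f$ is called the conformal scalar and $\omega$ the generating form of $\mathcal{V}$; the vector field $\mathcal{W}$ dual to $\omega$, i.e. $\langle\mathcal{W},X\rangle=\omega(X)$ for all $X\in\mathfrak{X}(M)$, is called the generative of $\mathcal{V}$. A torse-forming vector field is called proper if its generating form and conformal scalar are nowhere zero, in the sense that there is no (nonempty) open subset of $M$ on which $\omega$ and $f$ are identically zero. An anti-torqued vector field is a torse-forming vector field with $\mathcal{W}=-f\mathcal{V}$ on $M$, i.e. one satisfying $\nabla^0_X\mathcal{V}=f(X-\nu(X)\mathcal{V})$ for all $X\in\mathfrak{X}(M)$, where $\nu$ is the $1$-form dual to $\mathcal{V}$, $\nu(X)=\langle X,\mathcal{V}\rangle$. *)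

theory Defs
  imports "HOL-Analysis.Analysis"
begin

text \<open>
  HOL-Analysis has no smooth manifolds.  Tangent vectors are derivations at a point of the algebra
  of smooth functions, vector fields are smooth sections, and functions, one-forms, metrics and
  connections carry no constraint off the manifold, so that equations between them are always
  stated at the points of the manifold.
\<close>

section \<open>Smooth maps between Euclidean spaces\<close>

text \<open>Intended for open \<open>S\<close>, where \<open>frechet_derivative f (at x) b\<close> is the
  partial derivative in the direction \<open>b\<close>.\<close>

primrec Ck_on :: "nat \<Rightarrow> 'e::euclidean_space set \<Rightarrow> ('e \<Rightarrow> 'b::real_normed_vector) \<Rightarrow> bool" where
  "Ck_on 0 S f \<longleftrightarrow> continuous_on S f"
| "Ck_on (Suc k) S f \<longleftrightarrow>
     f differentiable_on S \<and> (\<forall>b\<in>Basis. Ck_on k S (\<lambda>x. frechet_derivative f (at x) b))"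

definition Cinf_on :: "'e::euclidean_space set \<Rightarrow> ('e \<Rightarrow> 'b::real_normed_vector) \<Rightarrow> bool" where
  "Cinf_on S f \<longleftrightarrow> (\<forall>k. Ck_on k S f)"


section \<open>Smooth manifolds\<close>

text \<open>The type \<open>'e\<close> is the model space, so \<open>DIM('e)\<close> is the (positive) dimension.  The atlas
  need not be maximal.\<close>

record ('a, 'e) manifold =
  mtop :: "'a topology"
  atlas :: "('a set \<times> ('a \<Rightarrow> 'e)) set"

abbreviation points :: "('a, 'e) manifold \<Rightarrow> 'a set" where
  "points M \<equiv> topspace (mtop M)"

definition smooth_manifold :: "('a, 'e::euclidean_space) manifold \<Rightarrow> bool" where
  "smooth_manifold M \<longleftrightarrow>
     Hausdorff_space (mtop M) \<and> second_countable (mtop M) \<and>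
     (\<Union>(U, \<phi>)\<in>atlas M. U) = points M \<and>
     (\<forall>(U, \<phi>)\<in>atlas M. openin (mtop M) U \<and> open (\<phi> ` U) \<and>
        homeomorphic_map (subtopology (mtop M) U) (top_of_set (\<phi> ` U)) \<phi>) \<and>
     (\<forall>(U, \<phi>)\<in>atlas M. \<forall>(V, \<psi>)\<in>atlas M. Cinf_on (\<phi> ` (U \<inter> V)) (\<psi> \<circ> inv_into U \<phi>))"

definition smooth_functions :: "('a, 'e::euclidean_space) manifold \<Rightarrow> ('a \<Rightarrow> real) set" where
  "smooth_functions M = {f. \<forall>(U, \<phi>)\<in>atlas M. Cinf_on (\<phi> ` U) (f \<circ> inv_into U \<phi>)}"


section \<open>Tangent vectors, vector fields and one-forms\<close>

type_synonym 'a tvec = "('a \<Rightarrow> real) \<Rightarrow> real"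
type_synonym 'a vfield = "'a \<Rightarrow> 'a tvec"
type_synonym 'a oneform = "'a \<Rightarrow> 'a tvec \<Rightarrow> real"

definition tzero :: "'a tvec" where
  "tzero = (\<lambda>\<phi>. 0)"

definition tadd :: "'a tvec \<Rightarrow> 'a tvec \<Rightarrow> 'a tvec" where
  "tadd u v = (\<lambda>\<phi>. u \<phi> + v \<phi>)"

definition tscale :: "real \<Rightarrow> 'a tvec \<Rightarrow> 'a tvec" where
  "tscale a v = (\<lambda>\<phi>. a * v \<phi>)"

text \<open>The last clause fixes the value on non-smooth functions, so that equal derivations are equal
  as functions.\<close>

definition tangent_space :: "('a, 'e::euclidean_space) manifold \<Rightarrow> 'a \<Rightarrow> 'a tvec set" where
  "tangent_space M p = {v.
     (\<forall>\<phi>\<in>smooth_functions M. \<forall>\<psi>\<in>smooth_functions M. \<forall>a b.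
        v (\<lambda>q. a * \<phi> q + b * \<psi> q) = a * v \<phi> + b * v \<psi>) \<and>
     (\<forall>\<phi>\<in>smooth_functions M. \<forall>\<psi>\<in>smooth_functions M.
        v (\<lambda>q. \<phi> q * \<psi> q) = v \<phi> * \<psi> p + \<phi> p * v \<psi>) \<and>
     (\<forall>\<phi>. \<phi> \<notin> smooth_functions M \<longrightarrow> v \<phi> = 0)}"

definition vector_fields :: "('a, 'e::euclidean_space) manifold \<Rightarrow> 'a vfield set" where
  "vector_fields M = {X.
     (\<forall>p\<in>points M. X p \<in> tangent_space M p) \<and>
     (\<forall>\<phi>\<in>smooth_functions M. (\<lambda>p. X p \<phi>) \<in> smooth_functions M)}"

definition vadd :: "'a vfield \<Rightarrow> 'a vfield \<Rightarrow> 'a vfield" where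
  "vadd X Y = (\<lambda>p. tadd (X p) (Y p))"

definition fscale :: "('a \<Rightarrow> real) \<Rightarrow> 'a vfield \<Rightarrow> 'a vfield" where
  "fscale f X = (\<lambda>p. tscale (f p) (X p))"

definition lie_bracket :: "'a vfield \<Rightarrow> 'a vfield \<Rightarrow> 'a vfield" where
  "lie_bracket X Y = (\<lambda>p \<phi>. X p (\<lambda>q. Y q \<phi>) - Y p (\<lambda>q. X q \<phi>))"

definition vf_eq :: "('a, 'e::euclidean_space) manifold \<Rightarrow> 'a vfield \<Rightarrow> 'a vfield \<Rightarrow> bool" where
  "vf_eq M X Y \<longleftrightarrow> (\<forall>p\<in>points M. X p = Y p)"

definition linear_on_tangent ::
    "('a, 'e::euclidean_space) manifold \<Rightarrow> 'a \<Rightarrow> ('a tvec \<Rightarrow> real) \<Rightarrow> bool" where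
  "linear_on_tangent M p l \<longleftrightarrow>
     (\<forall>u\<in>tangent_space M p. \<forall>v\<in>tangent_space M p. \<forall>a b.
        l (tadd (tscale a u) (tscale b v)) = a * l u + b * l v)"

definition one_forms :: "('a, 'e::euclidean_space) manifold \<Rightarrow> 'a oneform set" where
  "one_forms M = {\<omega>.
     (\<forall>p\<in>points M. linear_on_tangent M p (\<omega> p)) \<and>
     (\<forall>X\<in>vector_fields M. (\<lambda>p. \<omega> p (X p)) \<in> smooth_functions M)}"


section \<open>Riemannian metrics and the Levi-Civita connection\<close>

type_synonym 'a metric_tensor = "'a \<Rightarrow> 'a tvec \<Rightarrow> 'a tvec \<Rightarrow> real"
type_synonym 'a connection = "'a vfield \<Rightarrow> 'a vfield \<Rightarrow> 'a vfield"

definition riemannian_metric ::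
    "('a, 'e::euclidean_space) manifold \<Rightarrow> 'a metric_tensor \<Rightarrow> bool" where
  "riemannian_metric M g \<longleftrightarrow>
     (\<forall>p\<in>points M.
        (\<forall>v\<in>tangent_space M p. linear_on_tangent M p (\<lambda>u. g p u v)) \<and>
        (\<forall>u\<in>tangent_space M p. \<forall>v\<in>tangent_space M p. g p u v = g p v u) \<and>
        (\<forall>u\<in>tangent_space M p. u \<noteq> tzero \<longrightarrow> g p u u > 0)) \<and>
     (\<forall>X\<in>vector_fields M. \<forall>Y\<in>vector_fields M. (\<lambda>p. g p (X p) (Y p)) \<in> smooth_functions M)"

text \<open>\<open>nabla X Y\<close> is the covariant derivative of \<open>Y\<close> along \<open>X\<close>.\<close>

definition affine_connection ::
    "('a, 'e::euclidean_space) manifold \<Rightarrow> 'a connection \<Rightarrow> bool" where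
  "affine_connection M nabla \<longleftrightarrow>
     (\<forall>X\<in>vector_fields M. \<forall>Y\<in>vector_fields M. nabla X Y \<in> vector_fields M) \<and>
     (\<forall>X\<in>vector_fields M. \<forall>Y\<in>vector_fields M. \<forall>Z\<in>vector_fields M.
        \<forall>f\<in>smooth_functions M. \<forall>h\<in>smooth_functions M.
        vf_eq M (nabla (vadd (fscale f X) (fscale h Y)) Z)
                (vadd (fscale f (nabla X Z)) (fscale h (nabla Y Z)))) \<and>
     (\<forall>X\<in>vector_fields M. \<forall>Y\<in>vector_fields M. \<forall>Z\<in>vector_fields M.
        vf_eq M (nabla X (vadd Y Z)) (vadd (nabla X Y) (nabla X Z))) \<and>
     (\<forall>X\<in>vector_fields M. \<forall>Y\<in>vector_fields M. \<forall>f\<in>smooth_functions M.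
        vf_eq M (nabla X (fscale f Y))
                (vadd (fscale (\<lambda>p. X p f) Y) (fscale f (nabla X Y))))"

definition levi_civita ::
    "('a, 'e::euclidean_space) manifold \<Rightarrow> 'a metric_tensor \<Rightarrow> 'a connection \<Rightarrow> bool" where
  "levi_civita M g nabla \<longleftrightarrow>
     affine_connection M nabla \<and>
     (\<forall>X\<in>vector_fields M. \<forall>Y\<in>vector_fields M.
        vf_eq M (nabla X Y) (vadd (nabla Y X) (lie_bracket X Y))) \<and>
     (\<forall>X\<in>vector_fields M. \<forall>Y\<in>vector_fields M. \<forall>Z\<in>vector_fields M. \<forall>p\<in>points M.
        X p (\<lambda>q. g q (Y q) (Z q)) = g p (nabla X Y p) (Z p) + g p (Y p) (nabla X Z p))"


section \<open>Torse-forming vector fields\<close>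

text \<open>The conformal scalar \<open>f\<close> and the generating form \<open>\<omega>\<close> are arguments, since in
  dimension one they are not determined by \<open>V\<close>.\<close>

definition torse_forming ::
    "('a, 'e::euclidean_space) manifold \<Rightarrow> 'a connection \<Rightarrow>
     'a vfield \<Rightarrow> ('a \<Rightarrow> real) \<Rightarrow> 'a oneform \<Rightarrow> bool" where
  "torse_forming M nabla V f \<omega> \<longleftrightarrow>
     V \<in> vector_fields M \<and> (\<forall>p\<in>points M. V p \<noteq> tzero) \<and>
     f \<in> smooth_functions M \<and> \<omega> \<in> one_forms M \<and>
     (\<forall>X\<in>vector_fields M.
        vf_eq M (nabla X V) (vadd (fscale f X) (fscale (\<lambda>p. \<omega> p (X p)) V)))"

text \<open>The generative is the metric dual of the generating form.\<close>

definition generative ::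
    "('a, 'e::euclidean_space) manifold \<Rightarrow> 'a metric_tensor \<Rightarrow> 'a oneform \<Rightarrow> 'a vfield \<Rightarrow> bool" where
  "generative M g \<omega> W \<longleftrightarrow>
     W \<in> vector_fields M \<and>
     (\<forall>X\<in>vector_fields M. \<forall>p\<in>points M. g p (W p) (X p) = \<omega> p (X p))"

text \<open>Only the simultaneous vanishing of \<open>f\<close> and \<open>\<omega>\<close> on an open set is excluded.\<close>

definition proper_torse_forming ::
    "('a, 'e::euclidean_space) manifold \<Rightarrow> 'a connection \<Rightarrow>
     'a vfield \<Rightarrow> ('a \<Rightarrow> real) \<Rightarrow> 'a oneform \<Rightarrow> bool" where
  "proper_torse_forming M nabla V f \<omega> \<longleftrightarrow>
     torse_forming M nabla V f \<omega> \<and>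
     \<not> (\<exists>U. openin (mtop M) U \<and> U \<noteq> {} \<and>
          (\<forall>p\<in>U. f p = 0 \<and> (\<forall>v\<in>tangent_space M p. \<omega> p v = 0)))"

definition anti_torqued ::
    "('a, 'e::euclidean_space) manifold \<Rightarrow> 'a metric_tensor \<Rightarrow> 'a connection \<Rightarrow>
     'a vfield \<Rightarrow> ('a \<Rightarrow> real) \<Rightarrow> 'a oneform \<Rightarrow> bool" where
  "anti_torqued M g nabla V f \<omega> \<longleftrightarrow>
     torse_forming M nabla V f \<omega> \<and>
     (\<exists>W. generative M g \<omega> W \<and> vf_eq M W (fscale (\<lambda>p. - f p) V))"

definition vlength :: "'a metric_tensor \<Rightarrow> 'a vfield \<Rightarrow> 'a \<Rightarrow> real" where
  "vlength g V p = sqrt (g p (V p) (V p))"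

definition collinear_fields ::
    "('a, 'e::euclidean_space) manifold \<Rightarrow> 'a vfield \<Rightarrow> 'a vfield \<Rightarrow> bool" where
  "collinear_fields M V W \<longleftrightarrow>
     (\<forall>p\<in>points M. \<exists>a b. (a \<noteq> 0 \<or> b \<noteq> 0) \<and> tadd (tscale a (V p)) (tscale b (W p)) = tzero)"

end

theory Submission
  imports Defs
begin

text \<open>Differentiating the constant \<open>\<langle>V, V\<rangle> = c\<^sup>2\<close> along \<open>X\<close> gives
  \<open>f \<langle>X, V\<rangle> + c\<^sup>2 \<langle>W, X\<rangle> = 0\<close>, so \<open>f V + c\<^sup>2 W\<close> is orthogonal
  to both \<open>V\<close> and \<open>W\<close>, hence to itself, and vanishes.\<close>

section \<open>Calculus of \<open>Ck_on\<close> on open sets\<close>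

text \<open>On an open set the derivative at a point depends only on nearby values in the set. This
  lets a differentiation rule valid only on \<open>S\<close> be substituted inside
  \<open>Ck_on\<close>.\<close>

lemma Ck_on_cong:
  assumes "open S" and "\<And>x. x \<in> S \<Longrightarrow> f x = h x"
  shows "Ck_on k S f \<longleftrightarrow> Ck_on k S h"
  using assms(2)
proof (induction k arbitrary: f h)
  case 0
  then show ?case by (simp cong: continuous_on_cong)
next
  case (Suc k)
  \<comment> \<open>The equivalence is shown for every \<open>D\<close>, so the choice operator
    behind \<open>frechet_derivative\<close> picks the same derivative for both functions.\<close>
  have "(f has_derivative D) (at x) \<longleftrightarrow> (h has_derivative D) (at x)" if "x \<in> S" for x D
    using has_derivative_transform_within_open[OF _ assms(1) that, of f D UNIV h]
      has_derivative_transform_within_open[OF _ assms(1) that, of h D UNIV f] Suc.prems by auto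
  then have "f differentiable_on S \<longleftrightarrow> h differentiable_on S"
    and "\<And>x. x \<in> S \<Longrightarrow> frechet_derivative f (at x) = frechet_derivative h (at x)"
    using assms(1)
    by (auto simp: differentiable_on_eq_differentiable_at differentiable_def frechet_derivative_def)
  then show ?case
    using Suc.IH[of "\<lambda>x. frechet_derivative f (at x) b" "\<lambda>x. frechet_derivative h (at x) b" for b]
    by auto
qed

text \<open>Needed for the product rule, where undifferentiated factors appear next to derivatives
  and must be of the same class.\<close>

lemma Ck_on_SucD: "Ck_on (Suc k) S f \<Longrightarrow> Ck_on k S f"
proof (induction k arbitrary: f)
  case 0
  then show ?case by (simp add: differentiable_imp_continuous_on)
next
  case (Suc k)
  \<comment> \<open>Only one level of the recursion is unfolded, so that the partial derivatives
    keep the form to which the induction hypothesis applies.\<close>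
  have "f differentiable_on S"
    and "\<forall>b\<in>Basis. Ck_on (Suc k) S (\<lambda>x. frechet_derivative f (at x) b)"
    using Suc.prems Ck_on.simps(2)[of "Suc k" S f] by blast+
  then show ?case
    using Suc.IH by (simp only: Ck_on.simps(2)[of k]) blast
qed

lemma Ck_on_const: "Ck_on k S (\<lambda>x. a)"
  by (induction k arbitrary: a) (simp_all add: frechet_derivative_const)

lemma Ck_on_add:
  assumes "open S" "Ck_on k S f" "Ck_on k S h"
  shows "Ck_on k S (\<lambda>x. f x + h x)"
  using assms(2,3)
proof (induction k arbitrary: f h)
  case 0
  then show ?case by (simp add: continuous_on_add)
next
  case (Suc k)
  have diff: "f differentiable at x" "h differentiable at x" if "x \<in> S" for x
    using Suc.prems that assms(1) by (auto simp: differentiable_on_eq_differentiable_at)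
  have "Ck_on k S (\<lambda>x. frechet_derivative (\<lambda>x. f x + h x) (at x) b)" if "b \<in> Basis" for b
  proof -
    have eq: "frechet_derivative (\<lambda>x. f x + h x) (at x) b =
        frechet_derivative f (at x) b + frechet_derivative h (at x) b" if "x \<in> S" for x
      using has_derivative_add[OF diff[OF that, unfolded frechet_derivative_works]]
      by (simp add: frechet_derivative_at[symmetric])
    have "Ck_on k S (\<lambda>x. frechet_derivative f (at x) b + frechet_derivative h (at x) b)"
      using Suc.IH Suc.prems \<open>b \<in> Basis\<close> by simp
    then show ?thesis by (rule iffD2[OF Ck_on_cong[OF assms(1) eq], rotated])
  qed
  then show ?case using Suc.prems by (auto intro: derivative_intros)
qed

text \<open>By the product rule each partial derivative is a sum of two products of functions of
  class \<open>k\<close>, so the induction hypothesis and \<open>Ck_on_add\<close> apply.\<close>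

lemma Ck_on_mult:
  fixes f h :: "'e::euclidean_space \<Rightarrow> 'b::real_normed_algebra"
  assumes "open S" "Ck_on k S f" "Ck_on k S h"
  shows "Ck_on k S (\<lambda>x. f x * h x)"
  using assms(2,3)
proof (induction k arbitrary: f h)
  case 0
  then show ?case by (simp add: continuous_on_mult)
next
  case (Suc k)
  have diff: "f differentiable at x" "h differentiable at x" if "x \<in> S" for x
    using Suc.prems that assms(1) by (auto simp: differentiable_on_eq_differentiable_at)
  have "Ck_on k S (\<lambda>x. frechet_derivative (\<lambda>x. f x * h x) (at x) b)" if "b \<in> Basis" for b
  proof -
    have eq: "frechet_derivative (\<lambda>x. f x * h x) (at x) b =
        f x * frechet_derivative h (at x) b + frechet_derivative f (at x) b * h x"
      if "x \<in> S" for x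
      using has_derivative_mult[OF diff[OF that, unfolded frechet_derivative_works]]
      by (simp add: frechet_derivative_at[symmetric])
    have "Ck_on k S
        (\<lambda>x. f x * frechet_derivative h (at x) b + frechet_derivative f (at x) b * h x)"
      using Suc.prems \<open>b \<in> Basis\<close> Suc.prems[THEN Ck_on_SucD]
      by (auto intro!: Ck_on_add[OF assms(1)] Suc.IH)
    then show ?thesis by (rule iffD2[OF Ck_on_cong[OF assms(1) eq], rotated])
  qed
  then show ?case
    using diff assms(1) by (auto simp: differentiable_on_eq_differentiable_at)
qed

section \<open>Smooth functions on the manifold\<close>

lemma smooth_functions_mult:
  assumes "smooth_manifold M" "f \<in> smooth_functions M" "h \<in> smooth_functions M"
  shows "(\<lambda>p. f p * h p) \<in> smooth_functions M"
proof -
  have "Cinf_on (\<phi> ` U) ((\<lambda>p. f p * h p) \<circ> inv_into U \<phi>)" if "(U, \<phi>) \<in> atlas M" for U \<phi>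
  proof -
    have "open (\<phi> ` U)"
      using assms(1) that unfolding smooth_manifold_def by blast
    moreover have "Cinf_on (\<phi> ` U) (f \<circ> inv_into U \<phi>)" "Cinf_on (\<phi> ` U) (h \<circ> inv_into U \<phi>)"
      using assms(2,3) that by (auto simp: smooth_functions_def)
    ultimately show ?thesis
      using Ck_on_mult[of "\<phi> ` U" _ "f \<circ> inv_into U \<phi>" "h \<circ> inv_into U \<phi>"]
      by (simp add: Cinf_on_def o_def)
  qed
  then show ?thesis by (auto simp: smooth_functions_def)
qed

text \<open>Inverse charts take values in the manifold only, so smoothness ignores what
  \<open>f\<close> does elsewhere. Besides constants this covers the indicator of the
  complement.\<close>

lemma smooth_functions_constant_on_points:
  assumes "smooth_manifold M" "\<And>p. p \<in> points M \<Longrightarrow> f p = a"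
  shows "f \<in> smooth_functions M"
proof -
  have "Cinf_on (\<phi> ` U) (f \<circ> inv_into U \<phi>)" if "(U, \<phi>) \<in> atlas M" for U \<phi>
  proof -
    have "open (\<phi> ` U)" "U \<subseteq> points M"
      using assms(1) that unfolding smooth_manifold_def by blast+
    then have "Ck_on k (\<phi> ` U) (f \<circ> inv_into U \<phi>) \<longleftrightarrow> Ck_on k (\<phi> ` U) (\<lambda>x. a)" for k
      using assms(2) by (intro Ck_on_cong) (auto simp: inv_into_into subset_iff)
    then show ?thesis by (simp add: Cinf_on_def Ck_on_const)
  qed
  then show ?thesis by (auto simp: smooth_functions_def)
qed

section \<open>Derivations and vector fields\<close>

lemma tangent_space_linear:
  assumes "v \<in> tangent_space M p" "\<phi> \<in> smooth_functions M" "\<psi> \<in> smooth_functions M"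
  shows "v (\<lambda>q. a * \<phi> q + b * \<psi> q) = a * v \<phi> + b * v \<psi>"
  using assms unfolding tangent_space_def by blast

lemma tangent_space_Leibniz:
  assumes "v \<in> tangent_space M p" "\<phi> \<in> smooth_functions M" "\<psi> \<in> smooth_functions M"
  shows "v (\<lambda>q. \<phi> q * \<psi> q) = v \<phi> * \<psi> p + \<phi> p * v \<psi>"
  using assms unfolding tangent_space_def by blast

text \<open>Functions are unconstrained off the manifold; the idempotent \<open>k\<close>, the indicator of the
  complement, shows that derivations do not see the values there.\<close>

lemma tangent_space_constant_on_points:
  assumes M: "smooth_manifold M" and p: "p \<in> points M" and v: "v \<in> tangent_space M p"
    and \<phi>: "\<And>q. q \<in> points M \<Longrightarrow> \<phi> q = a"
  shows "v \<phi> = 0"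
proof -
  define k :: "'a \<Rightarrow> real" where "k q = of_bool (q \<notin> points M)" for q
  define h where "h q = 1 * \<phi> q + - a * 1" for q
  have smooth: "\<phi> \<in> smooth_functions M" "(\<lambda>q. 1) \<in> smooth_functions M"
    "k \<in> smooth_functions M" "h \<in> smooth_functions M"
    using \<phi> by (auto intro!: smooth_functions_constant_on_points[OF M] simp: k_def h_def)
  \<comment> \<open>Leibniz for 1 = 1 * 1 gives \<open>v 1 = 2 * v 1\<close>.\<close>
  have "v (\<lambda>q. 1) = 0"
    using tangent_space_Leibniz[OF v smooth(2,2)] by simp
  then have "v h = v \<phi>"
    using tangent_space_linear[OF v smooth(1,2), of 1 "- a"] by (simp add: h_def[abs_def])
  \<comment> \<open>On the manifold \<open>h\<close> vanishes, and off it \<open>k\<close> is 1.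
    Since \<open>h\<close> and \<open>k\<close> both vanish at \<open>p\<close>, Leibniz then kills
    \<open>v h\<close>.\<close>
  have "(\<lambda>q. h q * k q) = h"
    using \<phi> by (force simp: fun_eq_iff h_def k_def)
  then have "v h = 0"
    using tangent_space_Leibniz[OF v smooth(4,3)] p \<phi> by (simp add: h_def k_def)
  with \<open>v h = v \<phi>\<close> show ?thesis by simp
qed

lemma tangent_space_lincomb:
  assumes "u \<in> tangent_space M p" "v \<in> tangent_space M p"
  shows "tadd (tscale a u) (tscale b v) \<in> tangent_space M p"
  using assms unfolding tangent_space_def tadd_def tscale_def
  by (auto simp: algebra_simps)

lemma tangent_space_scale:
  assumes "v \<in> tangent_space M p"
  shows "tscale a v \<in> tangent_space M p"
  using tangent_space_lincomb[OF assms assms, of a 0] by (simp add: tadd_def tscale_def)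

lemma vector_fields_fscale:
  assumes "smooth_manifold M" "f \<in> smooth_functions M" "V \<in> vector_fields M"
  shows "fscale f V \<in> vector_fields M"
  unfolding vector_fields_def
proof (intro CollectI conjI ballI)
  fix p assume "p \<in> points M"
  then show "fscale f V p \<in> tangent_space M p"
    using assms(3) by (simp add: fscale_def vector_fields_def tangent_space_scale)
next
  fix \<phi> assume "\<phi> \<in> smooth_functions M"
  then have "(\<lambda>p. V p \<phi>) \<in> smooth_functions M"
    using assms(3) by (simp add: vector_fields_def)
  then show "(\<lambda>p. fscale f V p \<phi>) \<in> smooth_functions M"
    using smooth_functions_mult[OF assms(1,2)] by (simp add: fscale_def tscale_def)
qed

section \<open>Pointwise properties of the metric\<close>

lemma metric_lincomb_left:
  assumes "riemannian_metric M g" "p \<in> points M"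
    and "u \<in> tangent_space M p" "v \<in> tangent_space M p" "w \<in> tangent_space M p"
  shows "g p (tadd (tscale a u) (tscale b v)) w = a * g p u w + b * g p v w"
  using assms unfolding riemannian_metric_def linear_on_tangent_def by blast

lemma metric_sym:
  assumes "riemannian_metric M g" "p \<in> points M"
    and "u \<in> tangent_space M p" "v \<in> tangent_space M p"
  shows "g p u v = g p v u"
  using assms unfolding riemannian_metric_def by blast

lemma metric_pos:
  assumes "riemannian_metric M g" "p \<in> points M" "u \<in> tangent_space M p" "u \<noteq> tzero"
  shows "g p u u > 0"
  using assms unfolding riemannian_metric_def by blast

lemma vector_fields_tangent:
  "X \<in> vector_fields M \<Longrightarrow> p \<in> points M \<Longrightarrow> X p \<in> tangent_space M p"
  by (simp add: vector_fields_def)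

section \<open>Torse-forming fields of constant length\<close>

text \<open>Metric compatibility writes the vanishing derivative of the squared length as twice the
  product of \<open>nabla X V\<close> and \<open>V\<close>, which the torse-forming equation
  evaluates. Using \<omega> instead of a generative serves both the case where \<open>W\<close> is
  given and the case where it is constructed.\<close>

lemma torse_forming_constant_length:
  assumes M: "smooth_manifold M" and g: "riemannian_metric M g" and lc: "levi_civita M g nabla"
    and tf: "torse_forming M nabla V f \<omega>" and c: "\<And>p. p \<in> points M \<Longrightarrow> vlength g V p = c"
    and X: "X \<in> vector_fields M" and p: "p \<in> points M"
  shows "f p * g p (V p) (X p) + g p (V p) (V p) * \<omega> p (X p) = 0"
proof -
  have V: "V \<in> vector_fields M" using tf by (simp add: torse_forming_def)
  note tang = vector_fields_tangent[OF V] vector_fields_tangent[OF X]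
  \<comment> \<open>Squaring undoes \<open>sqrt\<close> because the metric is positive on the
    nonzero vector \<open>V q\<close>.\<close>
  have "g q (V q) (V q) = c\<^sup>2" if q: "q \<in> points M" for q
  proof -
    have "V q \<noteq> tzero" using tf q by (simp add: torse_forming_def)
    then show ?thesis
      using metric_pos[OF g q tang(1)[OF q]] c[OF q] by (auto simp: vlength_def)
  qed
  then have "X p (\<lambda>q. g q (V q) (V q)) = 0"
    by (rule tangent_space_constant_on_points[OF M p tang(2)[OF p]])
  moreover have "X p (\<lambda>q. g q (V q) (V q)) = g p (nabla X V p) (V p) + g p (V p) (nabla X V p)"
    using lc X V p unfolding levi_civita_def by blast
  moreover have nabla: "nabla X V p = tadd (tscale (f p) (X p)) (tscale (\<omega> p (X p)) (V p))"
    using tf X p by (simp add: torse_forming_def vf_eq_def vadd_def fscale_def)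
  moreover have "g p (V p) (nabla X V p) = g p (nabla X V p) (V p)"
    unfolding nabla using tang p by (intro metric_sym[OF g p] tangent_space_lincomb) auto
  moreover have "g p (nabla X V p) (V p) = f p * g p (X p) (V p) + \<omega> p (X p) * g p (V p) (V p)"
    unfolding nabla using tang p by (intro metric_lincomb_left[OF g p]) auto
  ultimately show ?thesis
    using metric_sym[OF g p tang(1)[OF p] tang(2)[OF p]] by (simp add: mult.commute)
qed

text \<open>The hypotheses on \<omega> and \<open>W\<close> speak of values of vector fields. This
  suffices, because \<open>Z\<close> is spanned at \<open>p\<close> by the values of the fields
  \<open>V\<close> and \<open>W\<close>.\<close>

lemma torse_forming_constant_length_collinear:
  assumes M: "smooth_manifold M" and g: "riemannian_metric M g" and lc: "levi_civita M g nabla"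
    and tf: "torse_forming M nabla V f \<omega>" and W: "generative M g \<omega> W"
    and c: "\<And>p. p \<in> points M \<Longrightarrow> vlength g V p = c"
  shows "collinear_fields M V W"
  unfolding collinear_fields_def
proof
  fix p assume p: "p \<in> points M"
  have V: "V \<in> vector_fields M" "V p \<noteq> tzero" using tf p by (auto simp: torse_forming_def)
  have W': "W \<in> vector_fields M" using W by (simp add: generative_def)
  note tang = vector_fields_tangent[OF V(1) p] vector_fields_tangent[OF W' p]
  define s where "s = g p (V p) (V p)"
  define Z where "Z = tadd (tscale (f p) (V p)) (tscale s (W p))"
  have Z: "Z \<in> tangent_space M p" unfolding Z_def by (intro tangent_space_lincomb tang)
  have orth: "g p Z (X p) = 0" if X: "X \<in> vector_fields M" for X
  proof -
    have "g p (W p) (X p) = \<omega> p (X p)" using W X p by (simp add: generative_def)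
    then show ?thesis
      using torse_forming_constant_length[OF M g lc tf c X p]
      by (simp add: Z_def s_def metric_lincomb_left[OF g p tang vector_fields_tangent[OF X p]])
  qed
  \<comment> \<open>Only the left \<open>Z\<close> is expanded; the right one stays intact so that
    \<open>orth\<close> applies after a swap by symmetry.\<close>
  have "g p Z Z = f p * g p (V p) Z + s * g p (W p) Z"
    by (subst (1) Z_def) (rule metric_lincomb_left[OF g p tang Z])
  also have "\<dots> = 0"
    using orth[OF V(1)] orth[OF W'] metric_sym[OF g p Z] tang by simp
  finally have "Z = tzero" using metric_pos[OF g p Z] by fastforce
  \<comment> \<open>The coefficient of \<open>W p\<close> is nonzero, so the relation is nontrivial
    even where \<open>f\<close> vanishes.\<close>
  moreover have "s > 0" unfolding s_def by (rule metric_pos[OF g p tang(1) V(2)])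
  ultimately show "\<exists>a b. (a \<noteq> 0 \<or> b \<noteq> 0) \<and> tadd (tscale a (V p)) (tscale b (W p)) = tzero"
    unfolding Z_def by (metis less_irrefl)
qed

text \<open>For squared length 1 the identity reads: \<omega> of \<open>X\<close> is
  \<open>- f\<close> times the product of \<open>V\<close> and \<open>X\<close>. Hence
  \<open>- f V\<close> is itself a generative and serves as the witness.\<close>

lemma torse_forming_unit_anti_torqued:
  assumes M: "smooth_manifold M" and g: "riemannian_metric M g" and lc: "levi_civita M g nabla"
    and tf: "torse_forming M nabla V f \<omega>" and unit: "\<And>p. p \<in> points M \<Longrightarrow> vlength g V p = 1"
  shows "anti_torqued M g nabla V f \<omega>"
proof -
  have V: "V \<in> vector_fields M" and f: "f \<in> smooth_functions M"
    using tf by (auto simp: torse_forming_def)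
  have "(\<lambda>p. - 1) \<in> smooth_functions M"
    by (rule smooth_functions_constant_on_points[OF M]) simp
  then have "(\<lambda>p. - f p) \<in> smooth_functions M"
    using smooth_functions_mult[OF M _ f] by fastforce
  then have "fscale (\<lambda>p. - f p) V \<in> vector_fields M"
    by (rule vector_fields_fscale[OF M _ V])
  moreover have "g p (fscale (\<lambda>p. - f p) V p) (X p) = \<omega> p (X p)"
    if X: "X \<in> vector_fields M" and p: "p \<in> points M" for X p
  proof -
    note tang = vector_fields_tangent[OF V p] vector_fields_tangent[OF X p]
    have "g p (V p) (V p) = 1" using unit[OF p] by (simp add: vlength_def)
    \<comment> \<open>A multiple of \<open>V p\<close> is read as a linear combination whose second
      coefficient is 0.\<close>
    moreover have "g p (fscale (\<lambda>p. - f p) V p) (X p) = - f p * g p (V p) (X p)"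
      using metric_lincomb_left[OF g p tang(1) tang(1) tang(2), of "- f p" 0]
      by (simp add: fscale_def tadd_def tscale_def)
    ultimately show ?thesis
      using torse_forming_constant_length[OF M g lc tf unit X p] by simp
  qed
  ultimately have "generative M g \<omega> (fscale (\<lambda>p. - f p) V)"
    by (simp add: generative_def)
  with tf show ?thesis by (auto simp: anti_torqued_def vf_eq_def)
qed

theorem proposition3p6:
  fixes M :: "('a, 'e::euclidean_space) manifold"
    and g :: "'a metric_tensor"
    and nabla :: "'a connection"
  assumes "smooth_manifold M"
    and "riemannian_metric M g"
    and "levi_civita M g nabla"
  shows "(\<forall>V f \<omega> W. proper_torse_forming M nabla V f \<omega> \<and> generative M g \<omega> W \<and>
            (\<exists>c. \<forall>p\<in>points M. vlength g V p = c)
            \<longrightarrow> collinear_fields M V W) \<and>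
         (\<forall>V f \<omega>. torse_forming M nabla V f \<omega> \<and> (\<forall>p\<in>points M. vlength g V p = 1)
            \<longrightarrow> anti_torqued M g nabla V f \<omega>)"
proof (intro conjI allI impI; elim conjE exE)
  fix V f \<omega> W c
  assume "proper_torse_forming M nabla V f \<omega>" and W: "generative M g \<omega> W"
    and c: "\<forall>p\<in>points M. vlength g V p = c"
  then have tf: "torse_forming M nabla V f \<omega>" by (simp add: proper_torse_forming_def)
  show "collinear_fields M V W"
    by (rule torse_forming_constant_length_collinear[OF assms tf W bspec[OF c]])
next
  fix V f \<omega>
  assume tf: "torse_forming M nabla V f \<omega>" and unit: "\<forall>p\<in>points M. vlength g V p = 1"
  show "anti_torqued M g nabla V f \<omega>"
    by (rule torse_forming_unit_anti_torqued[OF assms tf bspec[OF unit]])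
qed

end
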